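(* Let $b$ be a non-constant function which is a non-extreme point of $H^\infty_1$. Then there are no positive isometric measures for $\mathscr H(b)$; that is, there is no $\mu\in M_+(\mathbb D^-)$ such that every $f\in\mathscr H(b)$ is $\mu$-admissible and $\|f\|_b=\|f\|_\mu$ for all $f\in\mathscr H(b)$.
   Context: $\mathbb D$ is the open unit disk, $\mathbb D^-$ its closure, $\mathbb T=\partial\mathbb D$, $m$ normalized Lebesgue measure on $\mathbb T$. $H^\infty_1$ is the closed unit ball of $H^\infty$ (bounded analytic functions on $\mathbb D$ with sup norm). A function $b\in H^\infty_1$ is a non-extreme point of $H^\infty_1$ iff $\int_{\mathbb T}\log(1-|b|)\,dm>-\infty$. For $b\in H^\infty_1$, the de Branges–Rovnyak space $\mathscr H(b)$ is the reproducing kernel Hilbert space of analytic functions on $\mathbb D$ with reproducing kernel $k^b_\lambda(z)=\frac{1-\overline{b(\lambda)}b(z)}{1-\overline\lambda z}$ ($\lambda,z\in\mathbb D$); its norm is denoted $\|\cdot\|_b$. $M_+(\mathbb D^-)$ is the set of positive finite Borel measures on $\mathbb D^-$. For $\mu\in M_+(\mathbb D^-)$, an analytic function $f$ on $\mathbb D$ is $\mu$-admissible if its non-tangential limits exist $\mu$-almost everywhere on $\mathbb T$; such an $f$ is extended $\mu$-a.e. to $\mathbb T$ by its non-tangential limits, and $\|f\|_\mu$ denotes its $L^2(\mu)$ norm. *)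

theory Defs
  imports "HOL-Analysis.Analysis"
begin

abbreviation unit_disc :: "complex set" where
  "unit_disc \<equiv> ball 0 1"

abbreviation unit_circle :: "complex set" where
  "unit_circle \<equiv> sphere 0 1"

text \<open>The closed unit ball of \<open>H\<^sup>\<infinity>\<close>. Its members are functions on the disc; their values
  elsewhere are irrelevant.\<close>

definition Hinf_ball :: "(complex \<Rightarrow> complex) set" where
  "Hinf_ball = {f. f holomorphic_on unit_disc \<and> (\<forall>z\<in>unit_disc. norm (f z) \<le> 1)}"

text \<open>The function type is not an instance of \<^class>\<open>real_vector\<close>, and functions are identified
  when they agree on the disc, so \<open>extreme_point_of\<close> does not apply as it stands; this is its
  definition, read for functions on the disc.\<close>

definition extreme_point_Hinf_ball :: "(complex \<Rightarrow> complex) \<Rightarrow> bool" where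
  "extreme_point_Hinf_ball b \<longleftrightarrow> b \<in> Hinf_ball \<and>
     (\<forall>f\<in>Hinf_ball. \<forall>g\<in>Hinf_ball. \<forall>t::real. 0 < t \<and> t < 1 \<and>
        (\<forall>z\<in>unit_disc. b z = (1 - t) *\<^sub>R f z + t *\<^sub>R g z)
        \<longrightarrow> (\<forall>z\<in>unit_disc. f z = g z))"

definition non_extreme_point_Hinf_ball :: "(complex \<Rightarrow> complex) \<Rightarrow> bool" where
  "non_extreme_point_Hinf_ball b \<longleftrightarrow> b \<in> Hinf_ball \<and> \<not> extreme_point_Hinf_ball b"

text \<open>A complex Hilbert space \<open>H\<close> of functions on \<open>X\<close>, with inner product \<open>ip\<close> linear in the
  first argument, that has reproducing kernel \<open>k\<close>, where \<open>k w z\<close> is the value at \<open>z\<close> of the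
  kernel function of the point \<open>w\<close>. A function on \<open>X\<close> is represented by its extension by zero,
  so that equality of functions on \<open>X\<close> is equality in the function type. As a Hilbert
  function space is determined by its kernel, at most one \<open>H\<close>, and one \<open>ip\<close> on \<open>H\<close>, satisfies
  these conditions.\<close>

definition ip_norm ::
    "(('a \<Rightarrow> complex) \<Rightarrow> ('a \<Rightarrow> complex) \<Rightarrow> complex) \<Rightarrow> ('a \<Rightarrow> complex) \<Rightarrow> real" where
  "ip_norm ip f = sqrt (Re (ip f f))"

locale reproducing_kernel_Hilbert_space =
  fixes X :: "'a set" and k :: "'a \<Rightarrow> 'a \<Rightarrow> complex"
    and H :: "('a \<Rightarrow> complex) set" and ip :: "('a \<Rightarrow> complex) \<Rightarrow> ('a \<Rightarrow> complex) \<Rightarrow> complex"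
  assumes supported: "\<And>f x. f \<in> H \<Longrightarrow> x \<notin> X \<Longrightarrow> f x = 0"
    and zero_closed: "(\<lambda>_. 0) \<in> H"
    and add_closed: "\<And>f g. f \<in> H \<Longrightarrow> g \<in> H \<Longrightarrow> (\<lambda>x. f x + g x) \<in> H"
    and scale_closed: "\<And>c f. f \<in> H \<Longrightarrow> (\<lambda>x. c * f x) \<in> H"
    and ip_add_left: "\<And>f g h. f \<in> H \<Longrightarrow> g \<in> H \<Longrightarrow> h \<in> H \<Longrightarrow>
          ip (\<lambda>x. f x + g x) h = ip f h + ip g h"
    and ip_scale_left: "\<And>c f h. f \<in> H \<Longrightarrow> h \<in> H \<Longrightarrow> ip (\<lambda>x. c * f x) h = c * ip f h"
    and ip_cnj: "\<And>f g. f \<in> H \<Longrightarrow> g \<in> H \<Longrightarrow> ip g f = cnj (ip f g)"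
    and ip_nonneg: "\<And>f. f \<in> H \<Longrightarrow> 0 \<le> Re (ip f f)"
    and ip_definite: "\<And>f. f \<in> H \<Longrightarrow> ip f f = 0 \<Longrightarrow> f = (\<lambda>_. 0)"
    and complete: "\<And>\<sigma> :: nat \<Rightarrow> 'a \<Rightarrow> complex. range \<sigma> \<subseteq> H \<Longrightarrow>
          (\<forall>\<epsilon>>0. \<exists>N. \<forall>m\<ge>N. \<forall>n\<ge>N. ip_norm ip (\<lambda>x. \<sigma> m x - \<sigma> n x) < \<epsilon>) \<Longrightarrow>
          (\<exists>f\<in>H. (\<lambda>n. ip_norm ip (\<lambda>x. \<sigma> n x - f x)) \<longlonglongrightarrow> 0)"
    and kernel_mem: "\<And>w. w \<in> X \<Longrightarrow> (\<lambda>z. if z \<in> X then k w z else 0) \<in> H"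
    and reproducing: "\<And>f w. f \<in> H \<Longrightarrow> w \<in> X \<Longrightarrow>
          ip f (\<lambda>z. if z \<in> X then k w z else 0) = f w"

definition deBranges_Rovnyak_kernel :: "(complex \<Rightarrow> complex) \<Rightarrow> complex \<Rightarrow> complex \<Rightarrow> complex" where
  "deBranges_Rovnyak_kernel b w z = (1 - cnj (b w) * b z) / (1 - cnj w * z)"

text \<open>\<open>H\<close> with inner product \<open>ip\<close> is the space \<open>\<H>(b)\<close>.\<close>

definition is_deBranges_Rovnyak_space ::
    "(complex \<Rightarrow> complex) \<Rightarrow> (complex \<Rightarrow> complex) set \<Rightarrow>
     ((complex \<Rightarrow> complex) \<Rightarrow> (complex \<Rightarrow> complex) \<Rightarrow> complex) \<Rightarrow> bool" where
  "is_deBranges_Rovnyak_space b H ip \<longleftrightarrow>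
     reproducing_kernel_Hilbert_space unit_disc (deBranges_Rovnyak_kernel b) H ip \<and>
     (\<forall>f\<in>H. f holomorphic_on unit_disc)"

definition M_plus :: "complex measure set" where
  "M_plus = {\<mu>. finite_measure \<mu> \<and> sets \<mu> = sets (restrict_space borel (cball 0 1))}"

definition Stolz_region :: "real \<Rightarrow> complex \<Rightarrow> complex set" where
  "Stolz_region a \<zeta> = {z \<in> unit_disc. norm (z - \<zeta>) < a * (1 - norm z)}"

definition has_nontangential_limit ::
    "(complex \<Rightarrow> complex) \<Rightarrow> complex \<Rightarrow> complex \<Rightarrow> bool" where
  "has_nontangential_limit f \<zeta> l \<longleftrightarrow>
     (\<forall>a>1. (f \<longlongrightarrow> l) (at \<zeta> within Stolz_region a \<zeta>))"

definition admissible :: "complex measure \<Rightarrow> (complex \<Rightarrow> complex) \<Rightarrow> bool" where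
  "admissible \<mu> f \<longleftrightarrow> f holomorphic_on unit_disc \<and>
     (AE \<zeta> in \<mu>. \<zeta> \<in> unit_circle \<longrightarrow> (\<exists>l. has_nontangential_limit f \<zeta> l))"

text \<open>At points of the circle where there is no non-tangential limit the value 0 is a dummy;
  for admissible \<open>f\<close> these points are null.\<close>

definition nontangential_extension :: "(complex \<Rightarrow> complex) \<Rightarrow> complex \<Rightarrow> complex" where
  "nontangential_extension f z =
     (if z \<in> unit_disc then f z
      else if z \<in> unit_circle \<and> (\<exists>l. has_nontangential_limit f z l)
      then (THE l. has_nontangential_limit f z l)
      else 0)"

text \<open>The square of \<open>\<parallel>f\<parallel>\<^sub>\<mu>\<close>, with value \<open>\<infinity>\<close> if the extended function is not in \<open>L\<^sup>2(\<mu>)\<close>.\<close>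

definition L2_norm_sq :: "complex measure \<Rightarrow> (complex \<Rightarrow> complex) \<Rightarrow> ennreal" where
  "L2_norm_sq \<mu> f = (\<integral>\<^sup>+ z. ennreal ((norm (nontangential_extension f z))\<^sup>2) \<partial>\<mu>)"

text \<open>The equality of norms is stated for their squares in \<open>[0, \<infinity>]\<close>, so it includes
  that \<open>\<parallel>f\<parallel>\<^sub>\<mu>\<close> is finite.\<close>

definition positive_isometric_measure ::
    "(complex \<Rightarrow> complex) set \<Rightarrow> ((complex \<Rightarrow> complex) \<Rightarrow> (complex \<Rightarrow> complex) \<Rightarrow> complex) \<Rightarrow>
     complex measure \<Rightarrow> bool" where
  "positive_isometric_measure H ip \<mu> \<longleftrightarrow> \<mu> \<in> M_plus \<and>
     (\<forall>f\<in>H. admissible \<mu> f \<and> ennreal ((ip_norm ip f)\<^sup>2) = L2_norm_sq \<mu> f)"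

end

(*
  Non-extremality of b provides a holomorphic h = z^n g with g(0) nonzero and
  |b|^2 + |h|^2 <= 1. Put u = sum c_w s_w and v = sum c_w cnj(b(w)) s_w with the Szego kernels
  s_w. Integrating |h v|^2 <= |u - b v|^2 + (1 - |b|^2) |v|^2 over circles of radius r -> 1 gives
  |g(0) v(0)|^2 <= |sum c_w k_w|^2 (norm of H(b)), which says that b belongs to H(b). Hence, with
  F = k_z - k_w and G = cnj(z) k_z - cnj(w) k_w, the function M(x) = x G(x) belongs to H(b).
  An isometric measure on the closed disc forces |M| <= |G|, and <M, F> = |G|^2, so
  0 <= |M - F|^2 <= |F|^2 - |G|^2 = -|b(z) - b(w)|^2.
*)
theory Submission
  imports Defs "HOL-Complex_Analysis.Complex_Analysis"
begin

section \<open>Inner product identities, Cauchy-Schwarz and Riesz representation in an abstract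
  kernel space\<close>

context reproducing_kernel_Hilbert_space
begin

abbreviation K :: "'a \<Rightarrow> 'a \<Rightarrow> complex" where
  "K w \<equiv> (\<lambda>z. if z \<in> X then k w z else 0)"

lemma ip_add_right:
  assumes "f \<in> H" "g \<in> H" "h \<in> H"
  shows "ip h (\<lambda>x. f x + g x) = ip h f + ip h g"
  using assms ip_cnj[OF add_closed[of f g]] ip_cnj[of f h] ip_cnj[of g h]
  by (simp add: ip_add_left)

lemma ip_scale_right:
  assumes "f \<in> H" "h \<in> H"
  shows "ip h (\<lambda>x. c * f x) = cnj c * ip h f"
  using assms ip_cnj[OF scale_closed[of f c]] ip_cnj[of f h]
  by (simp add: ip_scale_left)

lemma lincomb_closed:
  assumes "f \<in> H" "g \<in> H"
  shows "(\<lambda>x. a * f x + c * g x) \<in> H"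
  using assms by (intro add_closed scale_closed)

lemma diff_closed:
  assumes "f \<in> H" "g \<in> H"
  shows "(\<lambda>x. f x - g x) \<in> H"
  using lincomb_closed[OF assms, of 1 "-1"] by simp

lemma ip_lincomb_left:
  assumes "f \<in> H" "g \<in> H" "h \<in> H"
  shows "ip (\<lambda>x. a * f x + c * g x) h = a * ip f h + c * ip g h"
  using assms by (simp add: ip_add_left ip_scale_left scale_closed)

lemma ip_lincomb_right:
  assumes "f \<in> H" "g \<in> H" "h \<in> H"
  shows "ip h (\<lambda>x. a * f x + c * g x) = cnj a * ip h f + cnj c * ip h g"
  using assms by (simp add: ip_add_right ip_scale_right scale_closed)

lemma ip_diff_right:
  assumes "f \<in> H" "g \<in> H" "h \<in> H"
  shows "ip h (\<lambda>x. f x - g x) = ip h f - ip h g"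
  using ip_lincomb_right[OF assms, of 1 "-1"] by simp

lemma ip_self: "f \<in> H \<Longrightarrow> ip f f = of_real (Re (ip f f))"
  using ip_cnj[of f f] by (simp add: complex_eq_iff)

lemma ip_norm_power2: "f \<in> H \<Longrightarrow> (ip_norm ip f)\<^sup>2 = Re (ip f f)"
  by (simp add: ip_norm_def ip_nonneg)

lemma Re_ip_lincomb:
  assumes "f \<in> H" "g \<in> H"
  shows "Re (ip (\<lambda>x. a * f x + c * g x) (\<lambda>x. a * f x + c * g x)) =
    (norm a)\<^sup>2 * Re (ip f f) + (norm c)\<^sup>2 * Re (ip g g) + 2 * Re (a * cnj c * ip f g)"
proof -
  have "ip (\<lambda>x. a * f x + c * g x) (\<lambda>x. a * f x + c * g x) =
      a * cnj a * ip f f + c * cnj c * ip g g + (a * cnj c * ip f g + cnj (a * cnj c * ip f g))"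
    using assms lincomb_closed[OF assms, of a c] ip_cnj[OF assms]
    by (simp add: ip_lincomb_left ip_lincomb_right algebra_simps)
  also have "\<dots> = of_real ((norm a)\<^sup>2) * ip f f + of_real ((norm c)\<^sup>2) * ip g g
      + of_real (2 * Re (a * cnj c * ip f g))"
    by (simp only: complex_norm_square complex_add_cnj)
  finally show ?thesis
    by simp
qed

lemma Re_ip_diff:
  assumes "f \<in> H" "g \<in> H"
  shows "Re (ip (\<lambda>x. f x - g x) (\<lambda>x. f x - g x)) =
    Re (ip f f) + Re (ip g g) - 2 * Re (ip f g)"
  using Re_ip_lincomb[OF assms, of 1 "-1"] by simp

lemma Cauchy_Schwarz:
  assumes f: "f \<in> H" and g: "g \<in> H"
  shows "norm (ip f g) \<le> ip_norm ip f * ip_norm ip g"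
proof (cases "ip g g = 0")
  case True
  then have "g = (\<lambda>x. 0 * f x)"
    using ip_definite[OF g] by simp
  then have "ip f g = 0"
    using ip_scale_right[OF f f, of 0] by simp
  then show ?thesis
    by (simp add: ip_norm_def f g ip_nonneg)
next
  case False
  define n p where "n = Re (ip g g)" and "p = ip f g"
  have n: "n > 0"
    using False ip_self[OF g] ip_nonneg[OF g] by (metis less_eq_real_def n_def of_real_0)
  \<comment> \<open>The vector is \<open>n\<close> times the component of \<open>f\<close>
    orthogonal to \<open>g\<close>; the factor \<open>n\<close> clears the denominator of the
    projection coefficient \<open>p / n\<close>.\<close>
  have "0 \<le> Re (ip (\<lambda>x. of_real n * f x + (- p) * g x) (\<lambda>x. of_real n * f x + (- p) * g x))"
    by (intro ip_nonneg lincomb_closed f g)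
  also have "\<dots> = n\<^sup>2 * Re (ip f f) + (norm p)\<^sup>2 * n - 2 * Re (of_real n * (p * cnj p))"
    unfolding Re_ip_lincomb[OF f g] by (simp add: n_def p_def algebra_simps)
  also have "\<dots> = n * (n * Re (ip f f) - (norm p)\<^sup>2)"
    unfolding complex_norm_square[symmetric] by (simp add: algebra_simps power2_eq_square)
  finally have "(norm p)\<^sup>2 \<le> Re (ip f f) * n"
    using n by (simp add: zero_le_mult_iff algebra_simps)
  also have "\<dots> = (ip_norm ip f * ip_norm ip g)\<^sup>2"
    by (simp add: power_mult_distrib ip_norm_power2 f g n_def)
  finally show ?thesis
    unfolding p_def by (rule power2_le_imp_le) (simp add: ip_norm_def f g ip_nonneg)
qed

text \<open>A minimizing sequence of \<open>\<parallel>F\<parallel>\<^sup>2 - 2 Re l\<close> over the graph \<open>\<Gamma>\<close> of the functional is Cauchy,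
  and its limit represents the functional.\<close>

lemma Riesz:
  assumes sub: "\<And>F l. (F, l) \<in> \<Gamma> \<Longrightarrow> F \<in> H"
    and ne: "\<Gamma> \<noteq> {}"
    and lin: "\<And>F l G m a c. (F, l) \<in> \<Gamma> \<Longrightarrow> (G, m) \<in> \<Gamma> \<Longrightarrow>
      ((\<lambda>x. a * F x + c * G x), a * l + c * m) \<in> \<Gamma>"
    and C: "C > 0" and bound: "\<And>F l. (F, l) \<in> \<Gamma> \<Longrightarrow> (norm l)\<^sup>2 \<le> C * Re (ip F F)"
  obtains G where "G \<in> H" "\<And>F l. (F, l) \<in> \<Gamma> \<Longrightarrow> ip F G = l"
proof -
  define J where "J = (\<lambda>p. Re (ip (fst p) (fst p)) - 2 * Re (snd p))"
  define M where "M = Inf (J ` \<Gamma>)"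
  have "- C \<le> J p" if "p \<in> \<Gamma>" for p
  proof -
    \<comment> \<open>AM-GM with weight \<open>C\<close>: the linear term costs at most |F|^2 + C,
      so the infimum of \<open>J\<close> is finite.\<close>
    have "2 * norm (snd p) \<le> (norm (snd p))\<^sup>2 / C + C"
      using zero_le_power2[of "norm (snd p) - C"] C
      by (simp add: field_simps power2_eq_square)
    also have "(norm (snd p))\<^sup>2 / C \<le> Re (ip (fst p) (fst p))"
      using bound[of "fst p" "snd p"] that C by (simp add: field_simps)
    finally show ?thesis
      using complex_Re_le_cmod[of "snd p"] by (simp add: J_def)
  qed
  then have bdd: "bdd_below (J ` \<Gamma>)"
    by (auto intro!: bdd_belowI)
  have M: "M \<le> J p" if "p \<in> \<Gamma>" for p
    unfolding M_def by (intro cInf_lower bdd imageI that)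
  have "\<exists>p\<in>\<Gamma>. J p < M + 1 / real (Suc n)" for n
    using cInf_lessD[of "J ` \<Gamma>" "M + 1 / real (Suc n)"] ne by (auto simp: M_def)
  then obtain p where p: "\<And>n. p n \<in> \<Gamma>" "\<And>n. J (p n) < M + 1 / real (Suc n)"
    by metis
  define F l where "F = (\<lambda>n. fst (p n))" and "l = (\<lambda>n. snd (p n))"
  have \<Gamma>: "(F n, l n) \<in> \<Gamma>" for n
    by (simp add: F_def l_def p)
  have FH: "F n \<in> H" for n
    using sub \<Gamma> by blast
  have near: "Re (ip (F n) (F n)) - 2 * Re (l n) < M + 1 / real (Suc n)" for n
    using p(2)[of n] by (simp add: J_def F_def l_def)
  \<comment> \<open>Parallelogram law: the midpoint of two members of \<Gamma> is again in \<Gamma>,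
    so its \<open>J\<close> is at least \<open>M\<close>, while both endpoints exceed
    \<open>M\<close> only slightly.\<close>
  have close: "Re (ip (\<lambda>x. F m x - F n x) (\<lambda>x. F m x - F n x))
      \<le> 2 / real (Suc m) + 2 / real (Suc n)" for m n
  proof -
    have "M \<le> J ((\<lambda>x. (1/2) * F m x + (1/2) * F n x), (1/2) * l m + (1/2) * l n)"
      by (intro M lin \<Gamma>)
    then have "M \<le> 1/4 * Re (ip (F m) (F m)) + 1/4 * Re (ip (F n) (F n))
        + 1/2 * Re (ip (F m) (F n)) - Re (l m) - Re (l n)"
      unfolding J_def fst_conv snd_conv Re_ip_lincomb[OF FH FH]
      by (simp add: norm_divide power_divide)
    moreover have "2 / real (Suc i) = 2 * (1 / real (Suc i))" for i
      by simp
    ultimately show ?thesis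
      unfolding Re_ip_diff[OF FH FH] using near[of m] near[of n] by linarith
  qed
  have "\<exists>G\<in>H. (\<lambda>n. ip_norm ip (\<lambda>x. F n x - G x)) \<longlonglongrightarrow> 0"
  proof (rule complete)
    show "\<forall>\<epsilon>>0. \<exists>N. \<forall>m\<ge>N. \<forall>n\<ge>N. ip_norm ip (\<lambda>x. F m x - F n x) < \<epsilon>"
    proof (intro allI impI)
      fix \<epsilon> :: real assume \<epsilon>: "0 < \<epsilon>"
      obtain N where N: "4 / \<epsilon>\<^sup>2 < real N"
        using reals_Archimedean2 by blast
      have small: "2 / real (Suc n) < \<epsilon>\<^sup>2 / 2" if "n \<ge> N" for n
      proof -
        have "4 / \<epsilon>\<^sup>2 < real (Suc n)"
          using N that by linarith
        then show ?thesis
          using \<epsilon> by (simp add: field_simps)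
      qed
      have "ip_norm ip (\<lambda>x. F m x - F n x) < \<epsilon>" if "m \<ge> N" "n \<ge> N" for m n
      proof -
        have "Re (ip (\<lambda>x. F m x - F n x) (\<lambda>x. F m x - F n x)) < \<epsilon>\<^sup>2"
          using close[of m n] small[of m] small[of n] that by linarith
        then show ?thesis
          unfolding ip_norm_def using \<epsilon> by (metis abs_of_pos real_sqrt_abs real_sqrt_less_iff)
      qed
      then show "\<exists>N. \<forall>m\<ge>N. \<forall>n\<ge>N. ip_norm ip (\<lambda>x. F m x - F n x) < \<epsilon>"
        by blast
    qed
  qed (use FH in auto)
  then obtain G where G: "G \<in> H" and lim: "(\<lambda>n. ip_norm ip (\<lambda>x. F n x - G x)) \<longlonglongrightarrow> 0"
    by blast
  have rep: "ip f G = m" if fm: "(f, m) \<in> \<Gamma>" for f m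
  proof -
    have f: "f \<in> H"
      using sub fm by blast
    have "(\<lambda>n. ip f (F n) - ip f G) \<longlonglongrightarrow> 0"
    proof (rule Lim_null_comparison)
      show "\<forall>\<^sub>F n in sequentially. norm (ip f (F n) - ip f G)
          \<le> ip_norm ip f * ip_norm ip (\<lambda>x. F n x - G x)"
        using Cauchy_Schwarz[OF f diff_closed[OF FH G]] ip_diff_right[OF FH G f] by simp
      show "(\<lambda>n. ip_norm ip f * ip_norm ip (\<lambda>x. F n x - G x)) \<longlonglongrightarrow> 0"
        using tendsto_mult_left[OF lim] by simp
    qed
    then have conv: "(\<lambda>n. ip f (F n)) \<longlonglongrightarrow> ip f G"
      by (simp add: LIM_zero_iff)
    \<comment> \<open>First variation: moving \<open>F n\<close> by \<open>t * f\<close> stays in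
      \<Gamma>, so \<open>J\<close> cannot fall below \<open>M\<close>. In the limit the term linear
      in \<open>t\<close> is dominated by the quadratic one for every complex
      \<open>t\<close>.\<close>
    have step: "2 * Re (t * (m - ip f G)) \<le> (norm t)\<^sup>2 * Re (ip f f)" for t
    proof (rule LIMSEQ_le[of "\<lambda>n. 2 * Re (t * (m - ip f (F n)))" _
            "\<lambda>n. 1 / real (Suc n) + (norm t)\<^sup>2 * Re (ip f f)"])
      show "(\<lambda>n. 2 * Re (t * (m - ip f (F n)))) \<longlonglongrightarrow> 2 * Re (t * (m - ip f G))"
        by (intro tendsto_intros conv)
      show "(\<lambda>n. 1 / real (Suc n) + (norm t)\<^sup>2 * Re (ip f f)) \<longlonglongrightarrow> (norm t)\<^sup>2 * Re (ip f f)"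
        using tendsto_add[OF LIMSEQ_Suc[OF lim_1_over_n] tendsto_const] by simp
      have "2 * Re (t * (m - ip f (F n))) \<le> 1 / real (Suc n) + (norm t)\<^sup>2 * Re (ip f f)" for n
      proof -
        have "M \<le> J ((\<lambda>x. t * f x + 1 * F n x), t * m + 1 * l n)"
          by (intro M lin \<Gamma> fm)
        then show ?thesis
          unfolding J_def fst_conv snd_conv Re_ip_lincomb[OF f FH]
          using near[of n] by (simp add: algebra_simps)
      qed
      then show "\<exists>N. \<forall>n\<ge>N. 2 * Re (t * (m - ip f (F n)))
          \<le> 1 / real (Suc n) + (norm t)\<^sup>2 * Re (ip f f)"
        by blast
    qed
    \<comment> \<open>With \<open>t = s * cnj d\<close> the inequality \<open>step\<close> reads
      2s|d|^2 <= s|d|^2 (s|f|^2). The summand 1 in \<open>s\<close> allows \<open>f = 0\<close> and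
      keeps s|f|^2 <= 1, which forces \<open>d = 0\<close>.\<close>
    define d s where "d = m - ip f G" and "s = 1 / (Re (ip f f) + 1)"
    have nn: "Re (ip f f) \<ge> 0"
      by (rule ip_nonneg[OF f])
    then have s: "s > 0" "s * Re (ip f f) \<le> 1"
      by (auto simp: s_def)
    have "2 * Re (of_real s * cnj d * d) = 2 * s * (norm d)\<^sup>2"
      unfolding cmod_power2 by (simp add: power2_eq_square algebra_simps)
    then have "2 * s * (norm d)\<^sup>2 \<le> (norm (of_real s * cnj d))\<^sup>2 * Re (ip f f)"
      using step[of "of_real s * cnj d"] by (simp add: d_def)
    also have "\<dots> = s * (norm d)\<^sup>2 * (s * Re (ip f f))"
      by (simp add: norm_mult power_mult_distrib power2_eq_square)
    also have "\<dots> \<le> s * (norm d)\<^sup>2 * 1"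
      using s by (intro mult_left_mono) auto
    finally have "s * (norm d)\<^sup>2 \<le> 0"
      by simp
    with s have "d = 0"
      by (simp add: mult_le_0_iff)
    then show ?thesis
      by (simp add: d_def)
  qed
  show ?thesis
    by (rule that[OF G rep])
qed

section \<open>Finite combinations of kernel functions and a membership criterion\<close>

lemma kernel_sum_mem:
  assumes "finite A" "A \<subseteq> X"
  shows "(\<lambda>x. \<Sum>w\<in>A. c w * K w x) \<in> H"
  using assms
proof (induction rule: finite_induct)
  case empty
  then show ?case
    using zero_closed by simp
next
  case (insert a A)
  then show ?case
    using add_closed[OF scale_closed[OF kernel_mem, of a "c a"]] by simp
qed

lemma ip_kernel_sum:
  assumes "finite A" "A \<subseteq> X" and f: "f \<in> H"
  shows "ip f (\<lambda>x. \<Sum>w\<in>A. c w * K w x) = (\<Sum>w\<in>A. cnj (c w) * f w)"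
  using assms(1,2)
proof (induction rule: finite_induct)
  case empty
  show ?case
    using ip_scale_right[OF f f, of 0] by simp
next
  case (insert a A)
  then have "ip f (\<lambda>x. c a * K a x + (\<Sum>w\<in>A. c w * K w x))
      = ip f (\<lambda>x. c a * K a x) + ip f (\<lambda>x. \<Sum>w\<in>A. c w * K w x)"
    by (intro ip_add_right kernel_sum_mem scale_closed kernel_mem f) auto
  also have "ip f (\<lambda>x. c a * K a x) = cnj (c a) * f a"
    using ip_scale_right[OF kernel_mem f, of a "c a"] reproducing[OF f, of a] insert by simp
  finally show ?case
    using insert by simp
qed

text \<open>The double sum is the squared norm of the sum of the c_w K_w, so the hypothesis bounds
  the functional that sends this sum to the sum of the c_w cnj(f w). Its Riesz representer agrees
  with \<open>f\<close> on \<open>X\<close>, as testing it against each \<open>K z\<close>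
  shows.\<close>

lemma mem_if_kernel_bound:
  assumes C: "C > 0"
    and bound: "\<And>A c. finite A \<Longrightarrow> A \<subseteq> X \<Longrightarrow>
      (norm (\<Sum>w\<in>A. c w * cnj (f w)))\<^sup>2
        \<le> C * Re (\<Sum>v\<in>A. \<Sum>w\<in>A. cnj (c v) * (c w * k w v))"
  shows "(\<lambda>z. if z \<in> X then f z else 0) \<in> H"
proof -
  \<comment> \<open>A relation instead of a function: kernel functions may be linearly dependent, so
    the coefficients need not be determined by their sum. \<open>Riesz\<close> takes a graph and
    asks for no proof of single-valuedness.\<close>
  define \<Gamma> where "\<Gamma> = {p. \<exists>A c. finite A \<and> A \<subseteq> X \<and>
      fst p = (\<lambda>x. \<Sum>w\<in>A. c w * K w x) \<and> snd p = (\<Sum>w\<in>A. c w * cnj (f w))}"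
  have \<Gamma>I: "((\<lambda>x. \<Sum>w\<in>A. c w * K w x), \<Sum>w\<in>A. c w * cnj (f w)) \<in> \<Gamma>"
    if "finite A" "A \<subseteq> X" for A c
    unfolding \<Gamma>_def mem_Collect_eq fst_conv snd_conv
    by (rule exI[of _ A], rule exI[of _ c]) (use that in simp)
  have \<Gamma>E: "\<exists>A c. finite A \<and> A \<subseteq> X \<and>
      F = (\<lambda>x. \<Sum>w\<in>A. c w * K w x) \<and> l = (\<Sum>w\<in>A. c w * cnj (f w))"
    if "(F, l) \<in> \<Gamma>" for F l
    using that unfolding \<Gamma>_def mem_Collect_eq fst_conv snd_conv .
  obtain G where G: "G \<in> H" "\<And>F l. (F, l) \<in> \<Gamma> \<Longrightarrow> ip F G = l"
  proof (rule Riesz[OF _ _ _ C, of \<Gamma>])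
    show "F \<in> H" if "(F, l) \<in> \<Gamma>" for F l
    proof -
      from \<Gamma>E[OF that] obtain A c where "finite A" "A \<subseteq> X" "F = (\<lambda>x. \<Sum>w\<in>A. c w * K w x)"
        by (elim exE conjE)
      then show ?thesis
        using kernel_sum_mem by simp
    qed
    show "\<Gamma> \<noteq> {}"
      using \<Gamma>I[of "{}"] by auto
    show "(norm l)\<^sup>2 \<le> C * Re (ip F F)" if "(F, l) \<in> \<Gamma>" for F l
    proof -
      from \<Gamma>E[OF that] obtain A c where A: "finite A" "A \<subseteq> X"
        and F: "F = (\<lambda>x. \<Sum>w\<in>A. c w * K w x)" and l: "l = (\<Sum>w\<in>A. c w * cnj (f w))"
        by (elim exE conjE)
      have "ip F F = (\<Sum>v\<in>A. cnj (c v) * F v)"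
        using ip_kernel_sum[OF A kernel_sum_mem[OF A]] by (simp add: F)
      also have "\<dots> = (\<Sum>v\<in>A. \<Sum>w\<in>A. cnj (c v) * (c w * k w v))"
        unfolding F sum_distrib_left using A by (intro sum.cong) auto
      finally show ?thesis
        using bound[OF A, of c] by (simp add: l)
    qed
    show "((\<lambda>x. a * F x + d * G x), a * l + d * m) \<in> \<Gamma>"
      if "(F, l) \<in> \<Gamma>" "(G, m) \<in> \<Gamma>" for F l G m a d
    proof -
      from \<Gamma>E[OF that(1)] obtain A c where A: "finite A" "A \<subseteq> X"
        and F: "F = (\<lambda>x. \<Sum>w\<in>A. c w * K w x)" "l = (\<Sum>w\<in>A. c w * cnj (f w))"
        by (elim exE conjE)
      from \<Gamma>E[OF that(2)] obtain B e where B: "finite B" "B \<subseteq> X"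
        and G: "G = (\<lambda>x. \<Sum>w\<in>B. e w * K w x)" "m = (\<Sum>w\<in>B. e w * cnj (f w))"
        by (elim exE conjE)
      \<comment> \<open>Both coefficient families are extended by zero to the union of their
        supports, so that they can be added pointwise.\<close>
      define h where "h = (\<lambda>w. a * (if w \<in> A then c w else 0) + d * (if w \<in> B then e w else 0))"
      have "a * (\<Sum>w\<in>A. c w * \<phi> w) + d * (\<Sum>w\<in>B. e w * \<phi> w) = (\<Sum>w\<in>A \<union> B. h w * \<phi> w)" for \<phi>
      proof -
        have "(\<Sum>w\<in>A. c w * \<phi> w) = (\<Sum>w\<in>A \<union> B. (if w \<in> A then c w else 0) * \<phi> w)"
          by (rule sum.mono_neutral_cong_left) (use A B in auto)
        moreover have "(\<Sum>w\<in>B. e w * \<phi> w) = (\<Sum>w\<in>A \<union> B. (if w \<in> B then e w else 0) * \<phi> w)"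
          by (rule sum.mono_neutral_cong_left) (use A B in auto)
        ultimately show ?thesis
          by (simp add: h_def distrib_right sum.distrib sum_distrib_left mult.assoc)
      qed
      then show ?thesis
        unfolding F G using \<Gamma>I[of "A \<union> B" h] A B by simp
    qed
  next
    fix G assume "G \<in> H" "\<And>F l. (F, l) \<in> \<Gamma> \<Longrightarrow> ip F G = l"
    then show thesis
      by (rule that)
  qed
  have "G z = f z" if "z \<in> X" for z
  proof -
    have "(K z, cnj (f z)) \<in> \<Gamma>"
      using \<Gamma>I[of "{z}" "\<lambda>_. 1"] that by simp
    then have "ip (K z) G = cnj (f z)"
      by (rule G)
    moreover have "ip G (K z) = cnj (ip (K z) G)"
      by (rule ip_cnj) (simp_all add: G kernel_mem that)
    ultimately show ?thesis
      using reproducing[OF G(1) that] by simp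
  qed
  then have "G = (\<lambda>z. if z \<in> X then f z else 0)"
    using supported[OF G(1)] by auto
  with G show ?thesis
    by simp
qed

end

section \<open>Cauchy integrals on circles and zeros at the origin\<close>

text \<open>On |z| = r one has cnj z = r^2 / z, which turns the conjugated Szego kernel into z / (z
  - r^2 w). The mean over the circle is then Cauchy's formula at r^2 w; the kernel belongs to the
  unit circle, which is why the point is not \<open>w\<close> itself.\<close>

lemma Szego_mean:
  assumes f: "f holomorphic_on unit_disc" and r: "0 < r" "r < 1" and w: "w \<in> unit_disc"
  shows "((\<lambda>t. f (circlepath 0 r t) * cnj (1 / (1 - cnj w * circlepath 0 r t)))
    has_integral f (of_real (r\<^sup>2) * w)) {0..1}"
proof -
  let ?a = "of_real (r\<^sup>2) * w"
  have "norm ?a < r"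
    using w r mult_strict_mono[of "r * r" r "norm w" 1] mult_strict_left_mono[of "r * norm w" 1 r]
      mult_strict_mono[of r 1 "norm w" 1]
    by (simp add: norm_mult power2_eq_square mult.assoc)
  moreover have "f holomorphic_on cball 0 r"
    using f by (rule holomorphic_on_subset) (use r in auto)
  ultimately have "((\<lambda>u. f u / (u - ?a)) has_contour_integral (2 * of_real pi * \<i> * f ?a)) (circlepath 0 r)"
    by (intro Cauchy_integral_circlepath_simple) auto
  then have "((\<lambda>t. 1 / (2 * of_real pi * \<i>) * (f (circlepath 0 r t) / (circlepath 0 r t - ?a) *
      vector_derivative (circlepath 0 r) (at t within {0..1})))
      has_integral (1 / (2 * of_real pi * \<i>) * (2 * of_real pi * \<i> * f ?a))) {0..1}"
    unfolding has_contour_integral_def by (rule has_integral_mult_right)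
  then have "((\<lambda>t. f (circlepath 0 r t) * cnj (1 / (1 - cnj w * circlepath 0 r t)))
      has_integral (1 / (2 * of_real pi * \<i>) * (2 * of_real pi * \<i> * f ?a))) {0..1}"
  proof (rule has_integral_eq[rotated])
    fix t :: real assume t: "t \<in> {0..1}"
    define z where "z = circlepath 0 r t"
    have z: "z = r * exp (2 * of_real pi * \<i> * t)"
      by (simp add: z_def circlepath)
    have nz: "norm z = r"
      using r by (simp add: z norm_mult)
    then have z0: "z \<noteq> 0"
      using r by auto
    have zz: "of_real (r\<^sup>2) = z * cnj z"
      using complex_norm_square[of z] nz by simp
    \<comment> \<open>If \<open>cnj z * w = 1\<close>, both denominators vanish and both sides are 0
      by the convention for division.\<close>
    have "z / (z - ?a) = cnj (1 / (1 - cnj w * z))"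
      using z0 unfolding zz by (cases "cnj z * w = 1") (simp_all add: field_simps)
    moreover have "vector_derivative (circlepath 0 r) (at t within {0..1}) = 2 * of_real pi * \<i> * z"
      using t by (simp add: vector_derivative_circlepath01 z)
    moreover have "1 / (2 * of_real pi * \<i>) * (f z / (z - ?a) * (2 * of_real pi * \<i> * z))
        = f z * (z / (z - ?a))"
    proof -
      have "1 / c * (x / y * (c * z)) = x * (z / y)" if "c \<noteq> 0" for c x y :: complex
        using that by simp
      from this[of "2 * of_real pi * \<i>" "f z" "z - ?a"] show ?thesis
        by (simp only: mult_eq_0_iff) simp
    qed
    ultimately show "1 / (2 * of_real pi * \<i>) * (f (circlepath 0 r t) / (circlepath 0 r t - ?a) *
        vector_derivative (circlepath 0 r) (at t within {0..1})) =
        f (circlepath 0 r t) * cnj (1 / (1 - cnj w * circlepath 0 r t))"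
      unfolding z_def[symmetric] by simp
  qed
  then show ?thesis
    by simp
qed


text \<open>Dividing out the zero at 0 makes evaluation at the origin informative; the removed
  factor \<open>z ^ n\<close> has constant modulus on each circle about 0 and tends to modulus 1 at
  the boundary.\<close>

lemma holomorphic_factor_origin:
  assumes h: "h holomorphic_on unit_disc" and p: "p \<in> unit_disc" "h p \<noteq> 0"
  obtains n g where "g holomorphic_on unit_disc" "g 0 \<noteq> 0"
    "\<And>z. z \<in> unit_disc \<Longrightarrow> h z = z ^ n * g z"
proof -
  define a where "a = (\<lambda>n. (deriv ^^ n) h 0 / fact n)"
  have sums: "(\<lambda>i. a i * z ^ i) sums h z" if "z \<in> unit_disc" for z
    using holomorphic_power_series[OF h that] by (simp add: a_def)
  have "\<exists>n. a n \<noteq> 0"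
  proof (rule ccontr)
    assume "\<nexists>n. a n \<noteq> 0"
    then have "(\<lambda>i. 0) sums h p"
      using sums[OF p(1)] by simp
    with p show False
      using sums_unique2[OF _ sums_zero] by blast
  qed
  then obtain n where n: "a n \<noteq> 0" "\<And>i. i < n \<Longrightarrow> a i = 0"
    using exists_least_iff[of "\<lambda>n. a n \<noteq> 0"] by blast
  define g where "g = (\<lambda>z. if z = 0 then a n else h z / z ^ n)"
  have gsums: "(\<lambda>i. a (i + n) * z ^ i) sums g z" if "z \<in> unit_disc" for z
  proof (cases "z = 0")
    case True
    then show ?thesis
      using powser_sums_zero[of "\<lambda>i. a (i + n)"] by (simp add: g_def)
  next
    case False
    have "(\<lambda>i. a (i + n) * z ^ (i + n)) sums (h z - (\<Sum>i<n. a i * z ^ i))"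
      by (rule sums_split_initial_segment[OF sums[OF that]])
    then have "(\<lambda>i. a (i + n) * z ^ (i + n)) sums h z"
      using n by simp
    then have "(\<lambda>i. a (i + n) * z ^ (i + n) / z ^ n) sums (h z / z ^ n)"
      by (rule sums_divide)
    then show ?thesis
      using False by (simp add: g_def power_add)
  qed
  show ?thesis
  proof
    show "g holomorphic_on unit_disc"
      by (rule power_series_holomorphic[of 0 1 "\<lambda>i. a (i + n)"]) (use gsums in simp)
    show "g 0 \<noteq> 0"
      by (simp add: g_def n)
    show "h z = z ^ n * g z" if "z \<in> unit_disc" for z
      \<comment> \<open>At the origin the series gives \<open>h 0 = a 0\<close>, which is
        \<open>g 0\<close> if \<open>n = 0\<close> and vanishes otherwise.\<close>
      using sums_unique2[OF sums[OF that], of "a 0"] powser_sums_zero[of a] n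
      by (cases "z = 0"; cases n) (auto simp: g_def)
  qed
qed

lemma one_minus_cnj_mult_nonzero:
  assumes "w \<in> unit_disc" "z \<in> unit_disc"
  shows "1 - cnj w * z \<noteq> 0"
proof
  assume "1 - cnj w * z = 0"
  then have "norm w * norm z = 1"
    by (metis complex_mod_cnj eq_iff_diff_eq_0 norm_mult norm_one)
  moreover have "norm w * norm z < 1 * 1"
    using assms by (intro mult_strict_mono') auto
  ultimately show False
    by simp
qed

section \<open>The kernel inequality for H(b) and its source in non-extremality\<close>

text \<open>Supplies the hypothesis of \<open>mem_if_kernel_bound\<close> for \<open>b\<close>. All
  integrals run over circles inside the disc, so boundary values of \<open>b\<close> never
  enter.\<close>

lemma deBranges_Rovnyak_kernel_bound:
  assumes b: "b holomorphic_on unit_disc" and g: "g holomorphic_on unit_disc"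
    and le: "\<And>z. z \<in> unit_disc \<Longrightarrow> (norm (b z))\<^sup>2 + (norm (z ^ n * g z))\<^sup>2 \<le> 1"
    and A: "finite A" "A \<subseteq> unit_disc"
  shows "(norm (g 0 * (\<Sum>w\<in>A. c w * cnj (b w))))\<^sup>2
    \<le> Re (\<Sum>v\<in>A. \<Sum>w\<in>A. cnj (c v) * (c w * deBranges_Rovnyak_kernel b w v))"
proof -
  define s :: "complex \<Rightarrow> complex \<Rightarrow> complex" where "s = (\<lambda>w z. 1 / (1 - cnj w * z))"
  define u v where "u = (\<lambda>z. \<Sum>w\<in>A. c w * s w z)"
    and "v = (\<lambda>z. \<Sum>w\<in>A. c w * cnj (b w) * s w z)"
  define F where "F = (\<lambda>z. g z * v z)"
  \<comment> \<open>The integrand has conjugated factors only through \<open>cnj u\<close> and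
    \<open>cnj v\<close>. Expanding these leaves a holomorphic \<phi> w against each conjugated
    Szego kernel, the form that \<open>Szego_mean\<close> evaluates. On the diagonal, \<phi> w w = u
    w - b w * v w.\<close>
  define \<phi> where "\<phi> = (\<lambda>w z. u z - 2 * b z * v z + b w * v z)"
  have F0: "F 0 = g 0 * (\<Sum>w\<in>A. c w * cnj (b w))"
    by (simp add: F_def v_def s_def)
  have s: "s w holomorphic_on unit_disc" if "w \<in> A" for w
    unfolding s_def using that A by (intro holomorphic_intros one_minus_cnj_mult_nonzero) auto
  have u: "u holomorphic_on unit_disc" and v: "v holomorphic_on unit_disc"
    unfolding u_def v_def by (intro holomorphic_intros s; assumption)+
  have F: "F holomorphic_on unit_disc" and \<phi>: "\<phi> w holomorphic_on unit_disc" for w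
    unfolding F_def \<phi>_def by (intro holomorphic_intros b g u v)+
  have expand: "u z * cnj (u z) - 2 * b z * v z * cnj (u z) + v z * cnj (v z)
      = (\<Sum>w\<in>A. cnj (c w) * (\<phi> w z * cnj (s w z)))" for z
  proof -
    have "(\<Sum>w\<in>A. cnj (c w) * (\<phi> w z * cnj (s w z))) =
        (\<Sum>w\<in>A. (u z - 2 * b z * v z) * (cnj (c w) * cnj (s w z))
          + v z * (cnj (c w) * b w * cnj (s w z)))"
      by (intro sum.cong) (simp_all add: \<phi>_def algebra_simps)
    also have "\<dots> = (u z - 2 * b z * v z) * cnj (u z) + v z * cnj (v z)"
      by (simp add: sum.distrib sum_distrib_left[symmetric] u_def v_def)
    finally show ?thesis
      by (simp add: algebra_simps)
  qed
  \<comment> \<open>The left side replaces |F|^2 by its tangent at \<open>F 0\<close>, a lower bound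
    that is affine in \<open>F\<close>, so the mean value property integrates it exactly. On the
    right, \<open>2 * b * v * cnj u\<close> stands for the two conjugate cross terms, which have the
    same real part.\<close>
  have pointwise: "r ^ (2 * n) * (2 * Re (cnj (F 0) * F z) - (norm (F 0))\<^sup>2)
      \<le> Re (u z * cnj (u z) - 2 * b z * v z * cnj (u z) + v z * cnj (v z))"
    if z: "norm z = r" and r: "0 < r" "r < 1" for r z
  proof -
    have "0 \<le> (norm (F z - F 0))\<^sup>2"
      by simp
    also have "\<dots> = (norm (F z))\<^sup>2 + (norm (F 0))\<^sup>2 - 2 * Re (cnj (F 0) * F z)"
      unfolding cmod_power2 by (simp add: power2_eq_square algebra_simps)
    finally have "r ^ (2 * n) * (2 * Re (cnj (F 0) * F z) - (norm (F 0))\<^sup>2)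
        \<le> r ^ (2 * n) * (norm (F z))\<^sup>2"
      using r by (intro mult_left_mono) auto
    also have "\<dots> = (norm (z ^ n * g z))\<^sup>2 * (norm (v z))\<^sup>2"
      by (simp add: F_def norm_mult norm_power z power_mult_distrib power_mult[symmetric] mult.commute)
    also have "\<dots> \<le> (1 - (norm (b z))\<^sup>2) * (norm (v z))\<^sup>2"
      using le[of z] z r by (intro mult_right_mono) auto
    also have "\<dots> \<le> (norm (u z - b z * v z))\<^sup>2 + (1 - (norm (b z))\<^sup>2) * (norm (v z))\<^sup>2"
      by simp
    also have "(norm (u z - b z * v z))\<^sup>2
        = (norm (u z))\<^sup>2 - 2 * Re (b z * v z * cnj (u z)) + (norm (b z * v z))\<^sup>2"
      unfolding cmod_power2 by (simp add: power2_eq_square algebra_simps)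
    also have "\<dots> + (1 - (norm (b z))\<^sup>2) * (norm (v z))\<^sup>2
        = (norm (u z))\<^sup>2 - 2 * Re (b z * v z * cnj (u z)) + (norm (v z))\<^sup>2"
      by (simp add: norm_mult power_mult_distrib algebra_simps)
    also have "\<dots> = Re (u z * cnj (u z) - 2 * (b z * v z * cnj (u z)) + v z * cnj (v z))"
      unfolding complex_norm_square[symmetric] by simp
    finally show ?thesis
      by (simp add: mult.assoc)
  qed
  have mean: "r ^ (2 * n) * (norm (F 0))\<^sup>2
      \<le> Re (\<Sum>w\<in>A. cnj (c w) * \<phi> w (of_real (r\<^sup>2) * w))"
    if r: "0 < r" "r < 1" for r
  proof -
    let ?\<gamma> = "circlepath 0 r"
    \<comment> \<open>At the point 0 the Szego kernel is 1, so \<open>Szego_mean\<close> becomes the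
      mean value property.\<close>
    have "((\<lambda>t. F (?\<gamma> t)) has_integral F 0) {0..1}"
      using Szego_mean[OF F r, of 0] by simp
    then have "((\<lambda>t. Re (cnj (F 0) * F (?\<gamma> t))) has_integral Re (cnj (F 0) * F 0)) {0..1}"
      by (intro has_integral_Re has_integral_mult_right)
    moreover have "cnj (F 0) * F 0 = of_real ((norm (F 0))\<^sup>2)"
      by (metis complex_norm_square mult.commute)
    ultimately have 1: "((\<lambda>t. Re (cnj (F 0) * F (?\<gamma> t))) has_integral (norm (F 0))\<^sup>2) {0..1}"
      by simp
    have 2: "((\<lambda>t. (norm (F 0))\<^sup>2) has_integral (norm (F 0))\<^sup>2) {0..1::real}"
      using has_integral_const_real[of "(norm (F 0))\<^sup>2" 0 1] by simp
    have "((\<lambda>t. r ^ (2 * n) * (2 * Re (cnj (F 0) * F (?\<gamma> t)) - (norm (F 0))\<^sup>2))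
        has_integral (r ^ (2 * n) * (2 * (norm (F 0))\<^sup>2 - (norm (F 0))\<^sup>2))) {0..1}"
      by (intro has_integral_mult_right has_integral_diff 1 2)
    then have lower: "((\<lambda>t. r ^ (2 * n) * (2 * Re (cnj (F 0) * F (?\<gamma> t)) - (norm (F 0))\<^sup>2))
        has_integral (r ^ (2 * n) * (norm (F 0))\<^sup>2)) {0..1}"
      by simp
    have "((\<lambda>t. \<Sum>w\<in>A. cnj (c w) * (\<phi> w (?\<gamma> t) * cnj (s w (?\<gamma> t))))
        has_integral (\<Sum>w\<in>A. cnj (c w) * \<phi> w (of_real (r\<^sup>2) * w))) {0..1}"
      unfolding s_def
      using A by (intro has_integral_sum has_integral_mult_right Szego_mean \<phi> r) auto
    then have upper: "((\<lambda>t. Re (\<Sum>w\<in>A. cnj (c w) * (\<phi> w (?\<gamma> t) * cnj (s w (?\<gamma> t)))))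
        has_integral Re (\<Sum>w\<in>A. cnj (c w) * \<phi> w (of_real (r\<^sup>2) * w))) {0..1}"
      by (rule has_integral_Re)
    show ?thesis
    proof (rule has_integral_le[OF lower upper])
      fix t :: real
      have "norm (?\<gamma> t) = r"
        using r by (simp add: circlepath norm_mult)
      then show "r ^ (2 * n) * (2 * Re (cnj (F 0) * F (?\<gamma> t)) - (norm (F 0))\<^sup>2)
          \<le> Re (\<Sum>w\<in>A. cnj (c w) * (\<phi> w (?\<gamma> t) * cnj (s w (?\<gamma> t))))"
        using pointwise[of "?\<gamma> t" r] r expand by simp
    qed
  qed
  \<comment> \<open>Let r tend to 1: the points r^2 w tend to the interior points \<open>w\<close>,
    where continuity of \<phi> w suffices.\<close>
  have "(norm (F 0))\<^sup>2 \<le> Re (\<Sum>w\<in>A. cnj (c w) * \<phi> w w)"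
  proof (rule tendsto_le)
    show "((\<lambda>r::real. r ^ (2 * n) * (norm (F 0))\<^sup>2) \<longlongrightarrow> (norm (F 0))\<^sup>2) (at_left 1)"
      by (rule tendsto_eq_intros refl | simp)+
    have "((\<lambda>r. \<phi> w (of_real (r\<^sup>2) * w)) \<longlongrightarrow> \<phi> w w) (at_left (1::real))" if "w \<in> A" for w
    proof (rule isCont_tendsto_compose[of w "\<phi> w"])
      show "isCont (\<phi> w) w"
        using that A holomorphic_on_imp_continuous_on[OF \<phi>]
        by (meson continuous_on_eq_continuous_at open_ball subsetD)
      have "((\<lambda>r::real. of_real (r\<^sup>2) * w) \<longlongrightarrow> of_real (1\<^sup>2) * w) (at_left 1)"
        by (intro tendsto_intros)
      then show "((\<lambda>r::real. of_real (r\<^sup>2) * w) \<longlongrightarrow> w) (at_left 1)"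
        by simp
    qed
    then show "((\<lambda>r::real. Re (\<Sum>w\<in>A. cnj (c w) * \<phi> w (of_real (r\<^sup>2) * w)))
        \<longlongrightarrow> Re (\<Sum>w\<in>A. cnj (c w) * \<phi> w w)) (at_left (1::real))"
      by (intro tendsto_Re tendsto_sum tendsto_mult_left)
    show "\<forall>\<^sub>F r::real in at_left 1. r ^ (2 * n) * (norm (F 0))\<^sup>2
        \<le> Re (\<Sum>w\<in>A. cnj (c w) * \<phi> w (of_real (r\<^sup>2) * w))"
      by (rule eventually_mono[OF eventually_at_left_real[of 0 1]]) (use mean in auto)
  qed simp
  also have "(\<Sum>v\<in>A. cnj (c v) * \<phi> v v)
      = (\<Sum>v\<in>A. \<Sum>w\<in>A. cnj (c v) * (c w * deBranges_Rovnyak_kernel b w v))"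
  proof (intro sum.cong refl)
    fix x
    have "\<phi> x x = u x - b x * v x"
      by (simp add: \<phi>_def)
    also have "\<dots> = (\<Sum>w\<in>A. c w * s w x - b x * (c w * cnj (b w) * s w x))"
      by (simp add: u_def v_def sum_subtractf sum_distrib_left)
    also have "\<dots> = (\<Sum>w\<in>A. c w * deBranges_Rovnyak_kernel b w x)"
      by (intro sum.cong) (simp_all add: deBranges_Rovnyak_kernel_def s_def diff_divide_distrib algebra_simps)
    finally show "cnj (c x) * \<phi> x x = (\<Sum>w\<in>A. cnj (c x) * (c w * deBranges_Rovnyak_kernel b w x))"
      by (simp add: sum_distrib_left)
  qed
  finally show ?thesis
    by (simp add: F0)
qed

text \<open>The convexity defect of the squared modulus is exact: |(1-t)f + tg|^2 + t(1-t)|f-g|^2 =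
  (1-t)|f|^2 + t|g|^2. Hence a nontrivial convex decomposition of \<open>b\<close> yields h =
  sqrt(t(1-t)) (f - g).\<close>

lemma non_extreme_imp_Pythagorean_mate:
  assumes "non_extreme_point_Hinf_ball b"
  obtains h p where "h holomorphic_on unit_disc" "p \<in> unit_disc" "h p \<noteq> 0"
    "\<And>z. z \<in> unit_disc \<Longrightarrow> (norm (b z))\<^sup>2 + (norm (h z))\<^sup>2 \<le> 1"
proof -
  from assms obtain f g t p where fg: "f \<in> Hinf_ball" "g \<in> Hinf_ball" and t: "0 < t" "t < (1::real)"
    and b: "\<And>z. z \<in> unit_disc \<Longrightarrow> b z = (1 - t) *\<^sub>R f z + t *\<^sub>R g z"
    and p: "p \<in> unit_disc" "f p \<noteq> g p"
    unfolding non_extreme_point_Hinf_ball_def extreme_point_Hinf_ball_def by blast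
  define h where "h = (\<lambda>z. of_real (sqrt (t * (1 - t))) * (f z - g z))"
  show ?thesis
  proof
    show "h holomorphic_on unit_disc"
      unfolding h_def using fg by (intro holomorphic_intros) (auto simp: Hinf_ball_def)
    show "h p \<noteq> 0"
      using t p by (simp add: h_def)
    fix z assume z: "z \<in> unit_disc"
    have "(norm (h z))\<^sup>2 = t * (1 - t) * (norm (f z - g z))\<^sup>2"
      using t by (simp add: h_def norm_mult power_mult_distrib)
    then have "(norm (b z))\<^sup>2 + (norm (h z))\<^sup>2 = (1 - t) * (norm (f z))\<^sup>2 + t * (norm (g z))\<^sup>2"
      unfolding b[OF z] cmod_power2 by (simp add: power2_eq_square algebra_simps)
    also have "\<dots> \<le> (1 - t) * 1 + t * 1"
      using fg z t by (intro add_mono mult_left_mono) (auto simp: Hinf_ball_def power_le_one)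
    finally show "(norm (b z))\<^sup>2 + (norm (h z))\<^sup>2 \<le> 1"
      by simp
  qed (rule p)
qed

section \<open>Non-tangential limits and multiplication by z in the norm of a measure\<close>

text \<open>Makes non-tangential limits unique. A radial point x = (1-d)\<zeta> satisfies |x -
  \<zeta>| = d = 1 - |x|, so it lies in every region of aperture above 1; 2 is one such
  choice.\<close>

lemma Stolz_region_nontrivial:
  assumes \<zeta>: "\<zeta> \<in> unit_circle"
  shows "at \<zeta> within Stolz_region 2 \<zeta> \<noteq> bot"
proof -
  have "\<zeta> islimpt Stolz_region 2 \<zeta>"
    unfolding islimpt_approachable
  proof (intro allI impI)
    fix e :: real assume e: "0 < e"
    define d where "d = min (1/2) (e/2)"
    have d: "0 < d" "d < 1" "d < e"
      using e by (auto simp: d_def)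
    define x where "x = of_real (1 - d) * \<zeta>"
    have "x - \<zeta> = - of_real d * \<zeta>"
      by (simp add: x_def algebra_simps)
    then have 1: "norm (x - \<zeta>) = d"
      using d \<zeta> by (simp add: norm_mult)
    have 2: "norm x = 1 - d"
      using d \<zeta> by (simp add: x_def norm_mult del: of_real_diff)
    show "\<exists>x'\<in>Stolz_region 2 \<zeta>. x' \<noteq> \<zeta> \<and> dist x' \<zeta> < e"
      by (rule bexI[of _ x]) (use 1 2 d in \<open>auto simp: Stolz_region_def dist_norm\<close>)
  qed
  then show ?thesis
    by (simp add: trivial_limit_within)
qed

lemma nontangential_extension_eq:
  assumes \<zeta>: "\<zeta> \<in> unit_circle" and l: "has_nontangential_limit f \<zeta> l"
  shows "nontangential_extension f \<zeta> = l"
proof -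
  have "m = l" if "has_nontangential_limit f \<zeta> m" for m
    using that l tendsto_unique[OF Stolz_region_nontrivial[OF \<zeta>]]
    unfolding has_nontangential_limit_def by (meson one_less_numeral_iff semiring_norm(76))
  with l have "(THE l. has_nontangential_limit f \<zeta> l) = l"
    by (rule the_equality)
  then show ?thesis
    using \<zeta> l by (auto simp: nontangential_extension_def)
qed

text \<open>The property of L2 norms on the closed disc that rules out isometric measures: |z| <= 1
  there, and a limit \<open>l\<close> at a boundary point \<open>z\<close> becomes
  \<open>z * l\<close>.\<close>

lemma L2_norm_sq_shift_le:
  assumes "admissible \<mu> f"
  shows "L2_norm_sq \<mu> (\<lambda>z. z * f z) \<le> L2_norm_sq \<mu> f"
proof -
  have "norm (nontangential_extension (\<lambda>z. z * f z) z) \<le> norm (nontangential_extension f z)"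
    if z: "z \<in> unit_circle \<longrightarrow> (\<exists>l. has_nontangential_limit f z l)" for z
  proof (cases "z \<in> unit_circle")
    case True
    then obtain l where l: "has_nontangential_limit f z l"
      using z by blast
    then have "has_nontangential_limit (\<lambda>x. x * f x) z (z * l)"
      unfolding has_nontangential_limit_def by (auto intro!: tendsto_intros)
    then show ?thesis
      using nontangential_extension_eq[OF True] l True by (simp add: norm_mult)
  next
    case False
    \<comment> \<open>Off the circle, either |z| < 1 or both extensions take the dummy value
      0.\<close>
    then show ?thesis
      by (auto simp: nontangential_extension_def norm_mult intro!: mult_left_le_one_le)
  qed
  then show ?thesis
    using assms unfolding L2_norm_sq_def admissible_def
    by (intro nn_integral_mono_AE) (auto elim!: eventually_mono intro!: ennreal_leI power_mono)
qed

section \<open>Comparing norms in H(b) under an isometric measure\<close>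

theorem theorem1p10:
  fixes b :: "complex \<Rightarrow> complex"
    and H :: "(complex \<Rightarrow> complex) set"
    and ip :: "(complex \<Rightarrow> complex) \<Rightarrow> (complex \<Rightarrow> complex) \<Rightarrow> complex"
  assumes "non_extreme_point_Hinf_ball b"
    and "\<not> b constant_on unit_disc"
    and "is_deBranges_Rovnyak_space b H ip"
  shows "\<not> (\<exists>\<mu>. positive_isometric_measure H ip \<mu>)"
proof
  assume "\<exists>\<mu>. positive_isometric_measure H ip \<mu>"
  then obtain \<mu> where \<mu>: "\<And>f. f \<in> H \<Longrightarrow> admissible \<mu> f"
    "\<And>f. f \<in> H \<Longrightarrow> ennreal ((ip_norm ip f)\<^sup>2) = L2_norm_sq \<mu> f"
    unfolding positive_isometric_measure_def by blast
  interpret reproducing_kernel_Hilbert_space unit_disc "deBranges_Rovnyak_kernel b" H ip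
    using assms(3) by (simp add: is_deBranges_Rovnyak_space_def)
  obtain h p where h: "h holomorphic_on unit_disc" and p: "p \<in> unit_disc" "h p \<noteq> 0"
    and bh: "\<And>z. z \<in> unit_disc \<Longrightarrow> (norm (b z))\<^sup>2 + (norm (h z))\<^sup>2 \<le> 1"
    using non_extreme_imp_Pythagorean_mate[OF assms(1)] by blast
  obtain n g where g: "g holomorphic_on unit_disc" "g 0 \<noteq> 0"
    and hg: "\<And>z. z \<in> unit_disc \<Longrightarrow> h z = z ^ n * g z"
    using holomorphic_factor_origin[OF h p] by blast
  have b: "b holomorphic_on unit_disc"
    using assms(1) by (simp add: non_extreme_point_Hinf_ball_def Hinf_ball_def)
  \<comment> \<open>Members of \<open>H\<close> vanish off the disc, so \<open>b\<close> has to be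
    cut off before it can belong to \<open>H\<close>.\<close>
  define B where "B = (\<lambda>z. if z \<in> unit_disc then b z else 0)"
  have B: "B \<in> H"
    unfolding B_def
  proof (rule mem_if_kernel_bound[of "1 / (norm (g 0))\<^sup>2"])
    show "0 < 1 / (norm (g 0))\<^sup>2"
      using g by simp
    show "(norm (\<Sum>w\<in>A. c w * cnj (b w)))\<^sup>2 \<le> 1 / (norm (g 0))\<^sup>2 *
        Re (\<Sum>v\<in>A. \<Sum>w\<in>A. cnj (c v) * (c w * deBranges_Rovnyak_kernel b w v))"
      if "finite A" "A \<subseteq> unit_disc" for A c
      using deBranges_Rovnyak_kernel_bound[OF b g(1) _ that, of n c] bh hg g(2)
      by (simp add: field_simps norm_mult power_mult_distrib)
  qed
  have "b z = b w" if z: "z \<in> unit_disc" and w: "w \<in> unit_disc" for z w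
  proof -
    have ker: "x * (cnj v * K v x) = K v x - (1 - cnj (b v) * b x)"
      if "v \<in> unit_disc" "x \<in> unit_disc" for v x
    proof -
      have "(1 - cnj v * x) * K v x = 1 - cnj (b v) * b x"
        using that one_minus_cnj_mult_nonzero[OF that] by (simp add: deBranges_Rovnyak_kernel_def)
      then show ?thesis
        by (simp only: left_diff_distrib mult_1 mult_ac) (simp add: algebra_simps)
    qed
    define F G where "F = (\<lambda>x. K z x - K w x)" and "G = (\<lambda>x. cnj z * K z x + (- cnj w) * K w x)"
    define M where "M = (\<lambda>x. x * G x)"
    have F: "F \<in> H" and G: "G \<in> H"
      unfolding F_def G_def by (intro diff_closed lincomb_closed kernel_mem z w)+
    \<comment> \<open>The constants of the two kernels cancel, which leaves a multiple of \<open>b\<close>.\<close>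
    have "M = (\<lambda>x. F x + cnj (b z - b w) * B x)"
    proof
      fix x
      show "M x = F x + cnj (b z - b w) * B x"
      proof (cases "x \<in> unit_disc")
        case True
        have "M x = x * (cnj z * K z x) - x * (cnj w * K w x)"
          by (simp add: M_def G_def algebra_simps)
        then show ?thesis
          unfolding ker[OF z True] ker[OF w True] using True
          by (simp add: F_def B_def algebra_simps)
      qed (simp add: M_def F_def G_def B_def)
    qed
    then have M: "M \<in> H"
      using add_closed[OF F scale_closed[OF B]] by simp
    \<comment> \<open>The only use of the measure: the isometry carries the contraction by
      \<open>z\<close> from L2 back to \<open>H\<close>, for the pair \<open>G\<close> and
      \<open>M\<close>, both of which lie in \<open>H\<close>.\<close>
    have "ennreal (Re (ip M M)) \<le> ennreal (Re (ip G G))"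
      using L2_norm_sq_shift_le[OF \<mu>(1)[OF G]] \<mu>(2)[OF G] \<mu>(2)[OF M]
      by (simp add: M_def[symmetric] ip_norm_power2 G M)
    then have contract: "Re (ip M M) \<le> Re (ip G G)"
      by (simp add: ip_nonneg G)
    have ipF: "ip f F = f z - f w" if "f \<in> H" for f
      unfolding F_def
      using ip_diff_right[OF kernel_mem[OF z] kernel_mem[OF w] that] reproducing[OF that] z w
      by simp
    have ipG: "ip G G = z * G z - w * G w"
      using ip_lincomb_right[OF kernel_mem[OF z] kernel_mem[OF w] G, of "cnj z" "- cnj w"]
        reproducing[OF G] z w
      unfolding G_def[symmetric] by simp
    \<comment> \<open>The same cancellation in the values of \<open>F\<close> and \<open>G\<close>;
      at \<open>z\<close> and \<open>w\<close> it computes |F|^2 - |G|^2.\<close>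
    have diff: "F x - x * G x = (cnj (b w) - cnj (b z)) * b x" if x: "x \<in> unit_disc" for x
    proof -
      have "F x - x * G x = F x - (x * (cnj z * K z x) - x * (cnj w * K w x))"
        by (simp add: G_def algebra_simps)
      then show ?thesis
        unfolding ker[OF z x] ker[OF w x] using x by (simp add: F_def algebra_simps)
    qed
    \<comment> \<open>Pairing with \<open>F\<close> takes the difference of values at
      \<open>z\<close> and \<open>w\<close>; for \<open>M\<close> these are z G(z) and w G(w), and
      the coefficients of \<open>G\<close> reproduce the same difference.\<close>
    have "ip M F = ip G G"
      unfolding ipF[OF M] ipG by (simp add: M_def)
    moreover have "0 \<le> Re (ip M M) + Re (ip F F) - 2 * Re (ip M F)"
      unfolding Re_ip_diff[OF M F, symmetric] by (intro ip_nonneg diff_closed M F)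
    ultimately have "0 \<le> Re (ip F F - ip G G)"
      using contract by simp
    also have "ip F F - ip G G = (F z - z * G z) - (F w - w * G w)"
      by (simp add: ipF[OF F] ipG)
    also have "\<dots> = (cnj (b w) - cnj (b z)) * b z - (cnj (b w) - cnj (b z)) * b w"
      by (simp only: diff[OF z] diff[OF w])
    also have "Re \<dots> = - (norm (b z - b w))\<^sup>2"
      unfolding cmod_power2 by (simp add: power2_eq_square algebra_simps)
    finally show ?thesis
      by simp
  qed
  with assms(2) show False
    unfolding constant_on_def by blast
qed

end
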